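(* Let $V$ be a finite set, $R$ an integral domain, and $w_{ij}=w_{ji}\in R$ ($i,j\in V$) symmetric weights with $w_{ii}=0$. Assume that the graph bracket $[f,g]_i=\sum_{j}w_{ij}(f_ig_j-f_jg_i)$ on $R^V$ satisfies the Jacobi identity. Let the support graph be the simple graph on $V$ whose edges are the pairs $\{i,j\}$ with $w_{ij}\neq0$. Then every connected component of the support graph is either an isolated vertex, a single edge, or a complete graph whose edges all carry the same weight.
   Context: The graph bracket is the $R$-bilinear antisymmetric map on $R^V$ given by $[f,g]_i=\sum_{j\in V}w_{ij}(f_ig_j-f_jg_i)$. The Jacobi identity is $[f,[g,h]]+[g,[h,f]]+[h,[f,g]]=0$ for all $f,g,h\in R^V$. *)

theory Defs
  imports "Graph_Theory.Graph_Theory"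
begin

text \<open>
  Elements of \<open>R\<^sup>V\<close> are represented by total functions of which only the values on the finite
  carrier set \<open>V\<close> matter: for \<open>i \<in> V\<close>, the value of the bracket at \<open>i\<close> depends only on the values
  of the arguments on \<open>V\<close>. Identities in \<open>R\<^sup>V\<close> are therefore stated pointwise for \<open>i \<in> V\<close>.
\<close>

definition graph_bracket ::
    "'v set \<Rightarrow> ('v \<Rightarrow> 'v \<Rightarrow> 'r::comm_ring_1) \<Rightarrow> ('v \<Rightarrow> 'r) \<Rightarrow> ('v \<Rightarrow> 'r) \<Rightarrow> 'v \<Rightarrow> 'r" where
  "graph_bracket V w f g i = (\<Sum>j\<in>V. w i j * (f i * g j - f j * g i))"

definition jacobi_identity_on ::
    "'v set \<Rightarrow> (('v \<Rightarrow> 'r::comm_ring_1) \<Rightarrow> ('v \<Rightarrow> 'r) \<Rightarrow> 'v \<Rightarrow> 'r) \<Rightarrow> bool" where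
  "jacobi_identity_on V br \<longleftrightarrow>
     (\<forall>f g h. \<forall>i\<in>V. br f (br g h) i + br g (br h f) i + br h (br f g) i = 0)"

text \<open>
  As usual in the graph library, an undirected simple graph is a symmetric loop-free digraph
  without parallel arcs: the edge \<open>{i, j}\<close> is the pair of arcs \<open>(i, j)\<close>, \<open>(j, i)\<close>. The connected
  components of such a graph are its strongly connected components.
\<close>

definition support_graph :: "'v set \<Rightarrow> ('v \<Rightarrow> 'v \<Rightarrow> 'r::zero) \<Rightarrow> ('v, 'v \<times> 'v) pre_digraph" where
  "support_graph V w =
     with_proj \<lparr> pverts = V, parcs = {(i, j). i \<in> V \<and> j \<in> V \<and> w i j \<noteq> 0} \<rparr>"

lemma graph_support_graph:
  assumes "finite V"
    and "\<And>i j. i \<in> V \<Longrightarrow> j \<in> V \<Longrightarrow> w i j = w j i"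
    and "\<And>i. i \<in> V \<Longrightarrow> w i i = 0"
  shows "graph (support_graph V w)"
proof -
  have "finite {(i, j). i \<in> V \<and> j \<in> V \<and> w i j \<noteq> 0}"
    by (rule finite_subset[of _ "V \<times> V"]) (use assms(1) in auto)
  then show ?thesis
    unfolding support_graph_def
    by unfold_locales (use assms in \<open>auto simp: arc_to_ends_def symmetric_def sym_def\<close>)
qed

definition isolated_vertex_graph :: "('v, 'e) pre_digraph \<Rightarrow> bool" where
  "isolated_vertex_graph H \<longleftrightarrow> (\<exists>u. verts H = {u}) \<and> arcs H = {}"

definition single_edge_graph :: "('v, 'e) pre_digraph \<Rightarrow> bool" where
  "single_edge_graph H \<longleftrightarrow>
     (\<exists>u v. u \<noteq> v \<and> verts H = {u, v} \<and> arcs_ends H = {(u, v), (v, u)})"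

end

theory Submission
  imports Defs
begin

text \<open>
  On the indicator functions of distinct vertices \<open>a\<close>, \<open>b\<close>, \<open>c\<close> the Jacobi identity, read off at
  \<open>a\<close>, says \<open>w\<^sub>b\<^sub>c (w\<^sub>a\<^sub>b - w\<^sub>a\<^sub>c) = 0\<close>. In an integral domain, two edges of the support graph that share
  a vertex therefore span a triangle with constant weight, and induction along walks propagates
  this to whole components. Isolated vertices and single edges are the complete graphs on one and
  two vertices, so every component is complete with constant weight.
\<close>

text \<open>The second argument stays arbitrary so that it can itself be a bracket, as in the double
  brackets of the Jacobi identity.\<close>

lemma graph_bracket_indicator_left:
  assumes "finite V" "i \<in> V" "a \<in> V"
  shows "graph_bracket V w (\<lambda>j. of_bool (j = a)) g i =
    of_bool (i = a) * (\<Sum>j\<in>V. w i j * g j) - w i a * g i"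
proof -
  have "(\<Sum>j\<in>V. w i j * (of_bool (j = a) * g i)) = (\<Sum>j\<in>V. if j = a then w i j * g i else 0)"
    by (intro sum.cong) auto
  also have "\<dots> = w i a * g i"
    using assms by simp
  finally show ?thesis
    by (simp add: graph_bracket_def right_diff_distrib sum_subtractf sum_distrib_left
        mult.left_commute)
qed

text \<open>With \<open>x = w b c\<close> the factor in parentheses is the bracket of two
  indicators, so this evaluates the weighted sum in the outer bracket.\<close>

lemma sum_mult_indicators_diff:
  fixes u :: "'v \<Rightarrow> 'r::comm_ring_1"
  assumes "finite V" "b \<in> V" "c \<in> V"
  shows "(\<Sum>j\<in>V. u j * (x * (of_bool (j = b) - of_bool (j = c)))) = x * (u b - u c)"
proof -
  have "(\<Sum>j\<in>V. u j * (x * (of_bool (j = b) - of_bool (j = c)))) =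
      (\<Sum>j\<in>V. (if j = b then u j * x else 0) - (if j = c then u j * x else 0))"
    by (intro sum.cong) auto
  then show ?thesis
    using assms by (simp add: sum_subtractf algebra_simps)
qed

text \<open>At \<open>b\<close> the bracket is \<open>- w b a\<close>, which symmetry turns into
  \<open>- w a b\<close>; for \<open>a = b\<close> both sides vanish.\<close>

lemma graph_bracket_indicators:
  assumes "finite V" "i \<in> V" "a \<in> V" "b \<in> V"
    and sym: "\<And>i j. i \<in> V \<Longrightarrow> j \<in> V \<Longrightarrow> w i j = w j i"
  shows "graph_bracket V w (\<lambda>j. of_bool (j = a)) (\<lambda>j. of_bool (j = b)) i =
    w a b * (of_bool (i = a) - of_bool (i = b))"
proof -
  have "(\<Sum>j\<in>V. w i j * of_bool (j = b)) = w i b"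
    using assms(1,4) by (simp add: of_bool_def if_distrib[of "(*) _"] cong: if_cong)
  then show ?thesis
    unfolding graph_bracket_indicator_left[OF assms(1-3)]
    using sym[OF assms(3,4)] by (cases "i = a"; cases "i = b") auto
qed

lemma jacobi_weights:
  fixes w :: "'v \<Rightarrow> 'v \<Rightarrow> 'r::comm_ring_1"
  assumes fin: "finite V"
    and sym: "\<And>i j. i \<in> V \<Longrightarrow> j \<in> V \<Longrightarrow> w i j = w j i"
    and loop: "\<And>i. i \<in> V \<Longrightarrow> w i i = 0"
    and jacobi: "jacobi_identity_on V (graph_bracket V w)"
    and abc: "a \<in> V" "b \<in> V" "c \<in> V" "a \<noteq> b" "a \<noteq> c"
  shows "w b c * (w a b - w a c) = 0"
proof -
  let ?e = "\<lambda>x j. of_bool (j = x) :: 'r"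
  let ?B = "graph_bracket V w"
  have "(\<Sum>j\<in>V. w a j * ?B (?e b) (?e c) j) = w b c * (w a b - w a c)"
    by (simp add: graph_bracket_indicators fin sym abc sum_mult_indicators_diff cong: sum.cong)
  \<comment> \<open>The correction term of the outer bracket at \<open>a\<close> carries the factor
    \<open>w a a = 0\<close>.\<close>
  then have "?B (?e a) (?B (?e b) (?e c)) a = w b c * (w a b - w a c)"
    by (simp add: graph_bracket_indicator_left fin abc loop)
  \<comment> \<open>This term and the next cancel by symmetry of \<open>w\<close>, so the first term
    alone must vanish.\<close>
  moreover have "?B (?e b) (?B (?e c) (?e a)) a = w a b * w c a"
    using abc by (simp add: graph_bracket_indicator_left graph_bracket_indicators fin sym)
  moreover have "?B (?e c) (?B (?e a) (?e b)) a = - (w a c * w a b)"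
    using abc by (simp add: graph_bracket_indicator_left graph_bracket_indicators fin sym)
  moreover have "?B (?e a) (?B (?e b) (?e c)) a + ?B (?e b) (?B (?e c) (?e a)) a
      + ?B (?e c) (?B (?e a) (?e b)) a = 0"
    using jacobi abc(1) unfolding jacobi_identity_on_def by blast
  ultimately show ?thesis
    using sym[of a c] abc by (simp add: mult.commute)
qed

lemma arcs_ends_support_graph:
  "(x, y) \<in> arcs_ends (support_graph V w) \<longleftrightarrow> x \<in> V \<and> y \<in> V \<and> w x y \<noteq> 0"
  by (auto simp: support_graph_def arcs_ends_def arc_to_ends_def)

text \<open>A walk from \<open>u\<close> is shortcut arc by arc: if \<open>u\<close> is adjacent to
  \<open>x\<close> and \<open>x\<close> to \<open>y\<close>, then \<open>jacobi_weights\<close> at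
  \<open>u\<close> and cancellation of \<open>w x y\<close> give \<open>w u y = w u x\<close>, which
  is nonzero.\<close>

lemma jacobi_reachable_imp_adjacent:
  fixes w :: "'v \<Rightarrow> 'v \<Rightarrow> 'r::idom"
  assumes "finite V"
    and sym: "\<And>i j. i \<in> V \<Longrightarrow> j \<in> V \<Longrightarrow> w i j = w j i"
    and loop: "\<And>i. i \<in> V \<Longrightarrow> w i i = 0"
    and "jacobi_identity_on V (graph_bracket V w)"
    and reach: "u \<rightarrow>\<^sup>*\<^bsub>support_graph V w\<^esub> v" and "u \<noteq> v"
  shows "w u v \<noteq> 0"
proof -
  interpret graph "support_graph V w"
    using assms(1-3) by (rule graph_support_graph)
  have "u = v \<or> w u v \<noteq> 0"
    using reach
  proof (induction rule: reachable_induct)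
    case (step x y)
    have V: "u \<in> V" "x \<in> V" "y \<in> V" and xy: "w x y \<noteq> 0"
      using step.hyps reachable_in_verts(1)[OF step.hyps(1)]
      by (auto simp: arcs_ends_support_graph support_graph_def)
    show ?case
    proof (cases "u = x \<or> u = y")
      case False
      then have "w x y * (w u x - w u y) = 0"
        by (intro jacobi_weights[OF assms(1-4)]) (use V in auto)
      with False xy step.IH show ?thesis by auto
    qed (use xy in auto)
  qed simp
  with \<open>u \<noteq> v\<close> show ?thesis by simp
qed

theorem corollary2p2:
  fixes V :: "'v set" and w :: "'v \<Rightarrow> 'v \<Rightarrow> 'r::idom"
  assumes "finite V"
    and "\<And>i j. i \<in> V \<Longrightarrow> j \<in> V \<Longrightarrow> w i j = w j i"
    and "\<And>i. i \<in> V \<Longrightarrow> w i i = 0"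
    and "jacobi_identity_on V (graph_bracket V w)"
  shows "\<forall>H \<in> pre_digraph.sccs (support_graph V w).
           isolated_vertex_graph H \<or>
           single_edge_graph H \<or>
           (complete_digraph (card (verts H)) H \<and>
            (\<exists>c. \<forall>e \<in> arcs H. w (tail H e) (head H e) = c))"
proof (intro ballI disjI2)
  let ?G = "support_graph V w"
  interpret G: graph ?G
    using assms(1-3) by (rule graph_support_graph)
  fix H assume "H \<in> G.sccs"
  then have ind: "induced_subgraph H ?G" and conn: "strongly_connected H"
    by auto
  interpret H: digraph H
    using ind by (rule G.digraphI_induced)
  interpret H: sym_digraph H
    using ind by (rule G.induced_graph_imp_graph)
  have "graph H"
    by unfold_locales (rule H.sym_arcs)
  have sub: "subgraph H ?G"
    using ind by (rule induced_imp_subgraph)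
  have verts: "verts H \<subseteq> V"
    using subgraph_imp_subverts[OF sub] by (simp add: support_graph_def)
  have nonzero: "w x y \<noteq> 0" if "x \<in> verts H" "y \<in> verts H" "x \<noteq> y" for x y
  proof -
    have "x \<rightarrow>\<^sup>*\<^bsub>H\<^esub> y"
      using conn that by blast
    then have "x \<rightarrow>\<^sup>*\<^bsub>?G\<^esub> y"
      using sub by (rule pre_digraph.reachable_mono)
    from assms this \<open>x \<noteq> y\<close> show ?thesis
      by (rule jacobi_reachable_imp_adjacent)
  qed
  have proj: "tail H = fst" "head H = snd"
    using sub by (auto simp: support_graph_def compatible_def)
  \<comment> \<open>Being induced, \<open>H\<close> has every arc of the support graph between its
    vertices; zero diagonal weights exclude the loops.\<close>
  have arcs: "arcs H = {(x, y). x \<in> verts H \<and> y \<in> verts H \<and> x \<noteq> y}"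
    using ind verts assms(3)
    by (auto simp: induced_subgraph_def support_graph_def nonzero)
  then have complete: "complete_digraph (card (verts H)) H"
    using \<open>graph H\<close> proj
    by (force simp: complete_digraph_def arcs_ends_conv)
  \<comment> \<open>Completeness makes the third side \<open>w b c\<close> of the triangle nonzero,
    so it can be cancelled.\<close>
  have star: "w a b = w a c"
    if "a \<in> verts H" "b \<in> verts H" "c \<in> verts H" "a \<noteq> b" "a \<noteq> c" for a b c
  proof (cases "b = c")
    case False
    have "w b c * (w a b - w a c) = 0"
      using that verts by (intro jacobi_weights[OF assms]) auto
    with nonzero[of b c] False that show ?thesis by simp
  qed simp
  have const: "w a b = w c d"
    if "(a, b) \<in> arcs H" "(c, d) \<in> arcs H" for a b c d
  proof (cases "a = c")
    case True
    with that star[of a b d] show ?thesis by (auto simp: arcs)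
  next
    \<comment> \<open>The arc joining the two tails links the given arcs: compare weights first at
      \<open>a\<close>, then at \<open>c\<close>.\<close>
    case False
    have "w a b = w a c" "w c a = w c d"
      by (rule star; use that False in \<open>simp add: arcs\<close>)+
    moreover have "w a c = w c a"
      using that verts by (intro assms(2)) (auto simp: arcs)
    ultimately show ?thesis by simp
  qed
  have "\<exists>c. \<forall>e \<in> arcs H. w (tail H e) (head H e) = c"
  \<comment> \<open>The common weight is read off an arbitrary arc; on an isolated vertex there is
    none and any constant serves.\<close>
  proof (cases "arcs H = {}")
    case False
    then obtain a b where "(a, b) \<in> arcs H" by auto
    then have "w (tail H e) (head H e) = w a b" if "e \<in> arcs H" for e
      using that by (simp add: proj const[of "fst e" "snd e" a b])
    then show ?thesis by blast
  qed simp
  with complete show "complete_digraph (card (verts H)) H \<and>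
      (\<exists>c. \<forall>e \<in> arcs H. w (tail H e) (head H e) = c)" ..
qed

end
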